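(* Let $p$ be a monic polynomial with complex coefficients of degree $n\ge 2$ whose zero set $Z(p)$ lies in the closed unit disk $\mathbb{D}$, let $z_1,\dots,z_n$ be its zeros listed with multiplicity, and let $w\in\mathbb{C}$ be a critical point of $p$ (i.e. $p'(w)=0$), with $r=|w|$, $0\le r\le 1$. If $n$ is even, then $$\operatorname{dist}(w,Z(p))\le E(r):=\sqrt{1-r^2}. \qquad (\mathrm{A})$$ If $n$ is odd, then $$\operatorname{dist}(w,Z(p))\le O_n(r):=(1+r)\sqrt{\frac{(n-1)(1-r)}{(n-1)+(n+1)r}}. \qquad (\mathrm{B})$$ Both estimates are sharp: for every $n\ge 2$ of the relevant parity and every $r\in[0,1]$, equality is attained by some such $p$ and some critical point $w$ of $p$ with $|w|=r$. More precisely, the equality cases are as follows. (1) Let $0<r<1$, $w=r$, and $m=\lfloor n/2\rfloor$. If $n$ is even, equality in (A) occurs precisely for $$p(z)=\left(z-r-i\sqrt{1-r^2}\right)^m\left(z-r+i\sqrt{1-r^2}\right)^m.$$ If $n$ is odd, equality in (B) occurs precisely for $$p(z)=(z+1)(z-e^{i\theta})^m(z-e^{-i\theta})^m,\qquad\text{where}\qquad \cos\theta=\frac{(2m+1)r^2+2mr+1}{2\bigl(m+(m+1)r\bigr)}.$$ (2) For $r=0$, equality (in (A) if $n$ is even, in (B) if $n$ is odd) holds precisely when all zeros of $p$ lie on the unit circle $\partial\mathbb{D}$ and $z_1+\cdots+z_n=w=0$. (3) For $r=1$, equality (in (A) if $n$ is even, in (B) if $n$ is odd) holds precisely when $w$ is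 a zero of $p$ with multiplicity at least $2$.
   Context: $\mathbb{D}=\{z\in\mathbb{C}:|z|\le 1\}$ is the closed unit disk and $\partial\mathbb{D}=\{z\in\mathbb{C}:|z|=1\}$. For a nonconstant polynomial $p$, $Z(p)$ denotes its set of complex zeros, and $\operatorname{dist}(w,Z(p))=\min_{z\in Z(p)}|z-w|$. In each equality statement, "precisely" characterizes equality among all monic polynomials $p$ of degree $n$ with all zeros in $\mathbb{D}$ that have $w$ as a critical point. *)

theory Defs
  imports "HOL-Analysis.Analysis"
begin

definition zeros :: "complex poly \<Rightarrow> complex set" where
  "zeros p = {z. poly p z = 0}"

(* Meaningful only for nonconstant p, whose zero set is finite and nonempty. *)
definition dist_zeros :: "complex \<Rightarrow> complex poly \<Rightarrow> real" where
  "dist_zeros w p = Min ((\<lambda>z. cmod (z - w)) ` zeros p)"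

definition admissible :: "nat \<Rightarrow> complex poly \<Rightarrow> bool" where
  "admissible n p \<longleftrightarrow> lead_coeff p = 1 \<and> degree p = n \<and> zeros p \<subseteq> cball 0 1"

definition critical_point :: "complex poly \<Rightarrow> complex \<Rightarrow> bool" where
  "critical_point p w \<longleftrightarrow> poly (pderiv p) w = 0"

definition E_bound :: "real \<Rightarrow> real" where
  "E_bound r = sqrt (1 - r\<^sup>2)"

definition O_bound :: "nat \<Rightarrow> real \<Rightarrow> real" where
  "O_bound n r =
     (1 + r) * sqrt (((real n - 1) * (1 - r)) / ((real n - 1) + (real n + 1) * r))"

definition sharp_bound :: "nat \<Rightarrow> real \<Rightarrow> real" where
  "sharp_bound n r = (if even n then E_bound r else O_bound n r)"

definition even_extremal :: "nat \<Rightarrow> real \<Rightarrow> complex poly" where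
  "even_extremal m r =
     [:- (complex_of_real r + \<i> * complex_of_real (sqrt (1 - r\<^sup>2))), 1:] ^ m *
     [:- (complex_of_real r - \<i> * complex_of_real (sqrt (1 - r\<^sup>2))), 1:] ^ m"

definition odd_extremal :: "nat \<Rightarrow> real \<Rightarrow> complex poly" where
  "odd_extremal m \<theta> = [:1, 1:] * [:- cis \<theta>, 1:] ^ m * [:- cis (- \<theta>), 1:] ^ m"

end

theory Submission
  imports Defs "HOL-Computational_Algebra.Fundamental_Theorem_Algebra"
begin

text \<open>
  Suppose \<open>p w \<noteq> 0\<close> and rotate so that \<open>w = r \<ge> 0\<close>. Put \<open>u\<^sub>k = 1 / (z\<^sub>k - w)\<close> and let \<open>d\<close> be the
  distance from \<open>w\<close> to the zeros. Then \<open>\<Sum> u\<^sub>k = 0\<close>, \<open>\<bar>u\<^sub>k\<bar> \<le> 1 / d\<close>, and \<open>\<bar>z\<^sub>k\<bar> \<le> 1\<close> says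
  \<open>1 + 2 r Re u\<^sub>k \<le> (1 - r\<^sup>2) \<bar>u\<^sub>k\<bar>\<^sup>2\<close>. Summing the last inequality gives \<open>d\<^sup>2 \<le> 1 - r\<^sup>2\<close>.

  For odd \<open>n = 2 m + 1\<close>, let \<open>a \<plusminus> i s\<close> be the two points where the last two constraints are tight;
  all \<open>u\<^sub>k\<close> have real part at most \<open>a\<close>. With \<open>\<mu> = s / (a + 1 / (1 + r))\<close>, a point \<open>x + i y\<close> with
  \<open>y \<ge> 0\<close> satisfies \<open>y - \<mu> (x - a) \<ge> s\<close> and one with \<open>y < 0\<close> satisfies \<open>y - \<mu> (x - a) \<ge> - s\<close>.
  Up to conjugation at least \<open>m + 1\<close> of the points are of the first kind, so summation yields
  \<open>n \<mu> a \<ge> s\<close>, which is the bound on \<open>d\<close>; equality forces every \<open>u\<^sub>k\<close> to be \<open>a \<plusminus> i s\<close> or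
  \<open>- 1 / (1 + r)\<close>.
\<close>

section \<open>Balanced odd configurations of plane points\<close>

text \<open>
  The circular-arc lower bound on \<open>y\<close> imposed by \<open>xy\<close> is concave and meets the line below at
  \<open>x = a\<close> and \<open>x = - 1 / (1 + r)\<close>.
\<close>

lemma upper_point_bound:
  fixes r a s x y :: real
  assumes r: "0 < r" "r < 1" and a: "0 \<le> a" and s: "0 < s" and xa: "x \<le> a" and y: "0 \<le> y"
    and s2: "(1 - r\<^sup>2) * s\<^sup>2 = (1 + (1 + r) * a) * (1 - (1 - r) * a)"
    and xy: "1 + 2 * r * x \<le> (1 - r\<^sup>2) * (x\<^sup>2 + y\<^sup>2)"
  defines "\<mu> \<equiv> s / (a + 1 / (1 + r))"
  shows "s + \<mu> * (x - a) \<le> y"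
    and "y = s + \<mu> * (x - a) \<Longrightarrow> x = a \<and> y = s \<or> x = - 1 / (1 + r) \<and> y = 0"
proof -
  \<comment> \<open>The height of the line at \<open>x\<close>, in units of \<open>s\<close>: 0 at
    \<open>x = - 1 / (1 + r)\<close> and 1 at \<open>x = a\<close>.\<close>
  define t where "t = (1 + (1 + r) * x) / (1 + (1 + r) * a)"
  have kap: "0 < 1 - r\<^sup>2" using r by (simp add: power_less_one_iff)
  have da: "0 < 1 + (1 + r) * a" using r a by (simp add: add_pos_nonneg)
  have "a + 1 / (1 + r) = (1 + (1 + r) * a) / (1 + r)" using r by (simp add: field_simps)
  then have mu: "\<mu> = s * (1 + r) / (1 + (1 + r) * a)" unfolding \<mu>_def by simp
  have line: "s + \<mu> * (x - a) = t * s"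
    unfolding mu t_def using da by (simp add: field_simps)
  have pa: "0 < 1 - (1 - r) * a"
    using s2 da kap s by (metis mult_pos_pos zero_less_mult_pos zero_less_power)
  \<comment> \<open>Once \<open>x^2\<close> is moved to the left, the quadratic in \<open>x\<close>
    factors, with roots \<open>- 1 / (1 + r)\<close> and \<open>1 / (1 - r)\<close>.\<close>
  have fac: "(1 + (1 + r) * x) * (1 - (1 - r) * x) \<le> (1 - r\<^sup>2) * y\<^sup>2"
    using xy by (simp add: algebra_simps power2_eq_square)
  consider "1 + (1 + r) * x < 0" | "1 + (1 + r) * x = 0" | "1 + (1 + r) * x > 0" by linarith
  then have "t * s \<le> y \<and> (y = t * s \<longrightarrow> x = a \<and> y = s \<or> x = - 1 / (1 + r) \<and> y = 0)"
  proof cases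
    case 1
    then have "t * s < 0" using da s unfolding t_def by (simp add: divide_neg_pos mult_neg_pos)
    then show ?thesis using y by linarith
  next
    case 2
    then have "t = 0" by (simp add: t_def)
    moreover have "x = - 1 / (1 + r)" using 2 r by (simp add: field_simps)
    ultimately show ?thesis using y by simp
  next
    case 3
    then have t0: "0 < t" using da by (simp add: t_def)
    have t1: "t \<le> 1" using xa r da by (simp add: t_def)
    \<comment> \<open>One factor \<open>t\<close> cancels against \<open>1 + (1 + r) * a\<close>, so
      both sides of the comparison with \<open>fac\<close> share the factor
      \<open>1 + (1 + r) * x\<close> and only the second factors remain to be compared.\<close>
    have key: "(1 - r\<^sup>2) * (t * s)\<^sup>2 = (1 + (1 + r) * x) * (t * (1 - (1 - r) * a))"
    proof -
      have "(1 - r\<^sup>2) * (t * s)\<^sup>2 = t * (t * ((1 + (1 + r) * a) * (1 - (1 - r) * a)))"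
        unfolding s2[symmetric] by (simp add: power2_eq_square algebra_simps)
      also have "t * (1 + (1 + r) * a) = 1 + (1 + r) * x" using da by (simp add: t_def)
      then have "t * (t * ((1 + (1 + r) * a) * (1 - (1 - r) * a))) = (1 + (1 + r) * x) * (t * (1 - (1 - r) * a))"
        by (metis mult.assoc mult.left_commute)
      finally show ?thesis .
    qed
    have mono: "1 - (1 - r) * a \<le> 1 - (1 - r) * x" using xa r by (simp add: mult_left_mono)
    have tle: "t * (1 - (1 - r) * a) \<le> 1 - (1 - r) * a" using pa t1 by simp
    have strict: "x < a \<Longrightarrow> t * (1 - (1 - r) * a) < 1 - (1 - r) * x"
      using tle mult_strict_left_mono[of x a "1 - r"] r by linarith
    have le: "(1 - r\<^sup>2) * (t * s)\<^sup>2 \<le> (1 - r\<^sup>2) * y\<^sup>2"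
      unfolding key using fac 3 tle mono
      by (meson dual_order.trans less_eq_real_def mult_left_mono)
    then have "(t * s)\<^sup>2 \<le> y\<^sup>2" using kap by simp
    then have "t * s \<le> y" using y by (rule power2_le_imp_le)
    moreover have "x = a \<and> y = s" if eq: "y = t * s"
    proof -
      have "\<not> x < a"
      proof
        assume "x < a"
        from mult_strict_left_mono[OF strict[OF this] 3] have "(1 - r\<^sup>2) * (t * s)\<^sup>2 < (1 - r\<^sup>2) * y\<^sup>2"
          using key fac by linarith
        then show False using eq by simp
      qed
      then have "x = a" using xa by simp
      then have "t = 1" using da by (simp add: t_def)
      then show ?thesis using \<open>x = a\<close> eq by simp
    qed
    ultimately show ?thesis by blast
  qed
  then show "s + \<mu> * (x - a) \<le> y"
    and "y = s + \<mu> * (x - a) \<Longrightarrow> x = a \<and> y = s \<or> x = - 1 / (1 + r) \<and> y = 0"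
    using line by auto
qed

text \<open>The tangent to the circle at \<open>(a, s)\<close> has slope \<open>- a / s\<close>, which is flatter than \<open>- \<mu>\<close>.\<close>

lemma lower_point_bound:
  fixes a s \<mu> x y :: real
  assumes s: "0 < s" and xa: "x \<le> a" and mu: "a < \<mu> * s" and circle: "x\<^sup>2 + y\<^sup>2 \<le> a\<^sup>2 + s\<^sup>2"
  shows "\<bar>y\<bar> \<le> s + \<mu> * (a - x)"
    and "\<bar>y\<bar> = s + \<mu> * (a - x) \<Longrightarrow> x = a \<and> \<bar>y\<bar> = s"
proof -
  \<comment> \<open>Expanded, this square together with \<open>circle\<close> is the tangent
    inequality \<open>a * x + s * \<bar>y\<bar> \<le> a^2 + s^2\<close>.\<close>
  have "0 \<le> (x - a)\<^sup>2 + (\<bar>y\<bar> - s)\<^sup>2" by simp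
  then have "s * \<bar>y\<bar> \<le> s * s + a * (a - x)"
    using circle by (simp add: power2_eq_square algebra_simps)
  moreover have "a * (a - x) \<le> (\<mu> * s) * (a - x)"
    using mu xa by (simp add: mult_right_mono)
  moreover have "a * (a - x) < (\<mu> * s) * (a - x)" if "x < a"
    using mu that by (simp add: mult_strict_right_mono)
  ultimately have *: "s * \<bar>y\<bar> \<le> s * (s + \<mu> * (a - x))"
    "x < a \<Longrightarrow> s * \<bar>y\<bar> < s * (s + \<mu> * (a - x))"
    by (auto simp: algebra_simps)
  from *(1) s show "\<bar>y\<bar> \<le> s + \<mu> * (a - x)" by simp
  assume eq: "\<bar>y\<bar> = s + \<mu> * (a - x)"
  with *(2) have "\<not> x < a" by auto
  with xa eq show "x = a \<and> \<bar>y\<bar> = s" by simp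
qed

text \<open>This is \<open>a < \<mu> * s\<close>, the hypothesis of
  \<open>lower_point_bound\<close>, with the denominator of \<open>\<mu>\<close> cleared.
  Eliminating \<open>s^2\<close> through \<open>E\<close> reduces it to a comparison of
  \<open>(1 - r) * (2 * h^2 + h)\<close> with \<open>(1 + 2 * r * a) * (1 + r)\<close> for
  \<open>h = (1 + r) * a\<close>; since \<open>h \<le> 1/2\<close>, the former is at most
  \<open>1 - r\<close>.\<close>

lemma slope_condition:
  fixes r a s :: real
  assumes r: "0 < r" "r < 1" and a: "0 \<le> a" "2 * (1 + r) * a \<le> 1" and E: "(1 - r\<^sup>2) * (a\<^sup>2 + s\<^sup>2) = 1 + 2 * r * a"
  shows "a * (a + 1 / (1 + r)) < s\<^sup>2"
proof -
  have kap: "0 < 1 - r\<^sup>2" using r by (simp add: power_less_one_iff)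
  define h where "h = (1 + r) * a"
  have h: "0 \<le> h" "h \<le> 1/2" using a r by (auto simp: h_def algebra_simps)
  have "h * h \<le> 1/2 * (1/2)" using h by (intro mult_mono) auto
  then have hh: "2 * (h * h) + h \<le> 1" using h by simp
  have "(1 - r) * (2 * (h * h) + h) \<le> (1 - r) * 1" by (rule mult_left_mono[OF hh]) (use r in simp)
  also have "\<dots> < 1 + r" using r by simp
  finally have "(1 - r) * (2 * (h * h) + h) < 1 + r" .
  moreover have "0 \<le> 2 * r * a * (1 + r)" using r a by simp
  ultimately have "(1 - r) * (2 * (h * h) + h) < (1 + 2 * r * a) * (1 + r)" by (simp add: algebra_simps)
  moreover have "(1 - r) * (2 * (h * h) + h) = ((1 - r\<^sup>2) * (2 * a\<^sup>2 + a / (1 + r))) * (1 + r)"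
    using r by (simp add: h_def field_simps power2_eq_square)
  ultimately have "(1 - r\<^sup>2) * (2 * a\<^sup>2 + a / (1 + r)) < 1 + 2 * r * a" using r by simp
  then have "(1 - r\<^sup>2) * (2 * a\<^sup>2 + a / (1 + r)) < (1 - r\<^sup>2) * (a\<^sup>2 + s\<^sup>2)" using E by simp
  then have "2 * a\<^sup>2 + a / (1 + r) < a\<^sup>2 + s\<^sup>2" using kap by simp
  then show ?thesis by (simp add: power2_eq_square algebra_simps)
qed

text \<open>The assumption \<open>am\<close> will encode that the distance is at least the claimed
  bound, so one argument yields both the bound and its equality cases. Each point has a nonnegative
  slack \<open>t z\<close> over its line; the weighted total slack is at most a positive multiple of
  \<open>2 * m * (1 + r) * a - 1\<close>, hence zero, and every slack vanishes.\<close>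

lemma odd_configuration_upper:
  fixes N :: "'a \<Rightarrow> nat" and x y :: "'a \<Rightarrow> real"
  assumes fin: "finite Z" and Npos: "\<And>z. z \<in> Z \<Longrightarrow> 0 < N z"
    and card: "(\<Sum>z\<in>Z. N z) = 2 * m + 1"
    and sumx: "(\<Sum>z\<in>Z. real (N z) * x z) = 0" and sumy: "(\<Sum>z\<in>Z. real (N z) * y z) = 0"
    and r: "0 < r" "r < 1" and m: "1 \<le> m" and s: "0 < s" and a0: "0 \<le> a"
    and E: "(1 - r\<^sup>2) * (a\<^sup>2 + s\<^sup>2) = 1 + 2 * r * a"
    and am: "2 * real m * (1 + r) * a \<le> 1"
    and in_disk: "\<And>z. z \<in> Z \<Longrightarrow> 1 + 2 * r * x z \<le> (1 - r\<^sup>2) * ((x z)\<^sup>2 + (y z)\<^sup>2)"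
    and far: "\<And>z. z \<in> Z \<Longrightarrow> (x z)\<^sup>2 + (y z)\<^sup>2 \<le> a\<^sup>2 + s\<^sup>2"
    and upper: "m + 1 \<le> (\<Sum>z | z \<in> Z \<and> 0 \<le> y z. N z)"
  shows "2 * real m * (1 + r) * a = 1 \<and>
    (\<forall>z\<in>Z. x z = a \<and> \<bar>y z\<bar> = s \<or> x z = - 1 / (1 + r) \<and> y z = 0)"
proof -
  have kap: "0 < 1 - r\<^sup>2" using r by (simp add: power_less_one_iff)
  define \<mu> where "\<mu> = s / (a + 1 / (1 + r))"
  have den: "0 < a + 1 / (1 + r)" using a0 r by (simp add: add_nonneg_pos)
  have mu0: "0 < \<mu>" using den s by (simp add: \<mu>_def)
  have "1 * (2 * (1 + r) * a) \<le> real m * (2 * (1 + r) * a)"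
    using m r a0 by (intro mult_right_mono) auto
  then have "2 * (1 + r) * a \<le> 1" using am by (simp add: algebra_simps)
  from slope_condition[OF r a0 this E] have "a * (a + 1 / (1 + r)) < s\<^sup>2" .
  then have mus: "a < \<mu> * s" using den by (simp add: \<mu>_def pos_less_divide_eq power2_eq_square)
  \<comment> \<open>Chain \<open>in_disk\<close>, \<open>far\<close> and \<open>E\<close>:
    \<open>1 + 2 * r * x z\<close> is at most
    \<open>(1 - r^2) * (a^2 + s^2) = 1 + 2 * r * a\<close>.\<close>
  have xa: "x z \<le> a" if "z \<in> Z" for z
  proof -
    have "1 + 2 * r * x z \<le> 1 + 2 * r * a"
      using in_disk[OF that] mult_left_mono[OF far[OF that], of "1 - r\<^sup>2"] kap E by linarith
    then show ?thesis using r by simp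
  qed
  have s2: "(1 - r\<^sup>2) * s\<^sup>2 = (1 + (1 + r) * a) * (1 - (1 - r) * a)"
    using E by (simp add: algebra_simps power2_eq_square)
  define \<sigma> :: "'a \<Rightarrow> real" where "\<sigma> z = (if 0 \<le> y z then 1 else - 1)" for z
  define t where "t z = y z - \<mu> * (x z - a) - \<sigma> z * s" for z
  have t0: "0 \<le> t z" and t_eq: "t z = 0 \<Longrightarrow> x z = a \<and> \<bar>y z\<bar> = s \<or> x z = - 1 / (1 + r) \<and> y z = 0"
    if z: "z \<in> Z" for z
  proof -
    note A = upper_point_bound[OF r a0 s xa[OF z] _ s2 in_disk[OF z], folded \<mu>_def]
    note B = lower_point_bound[OF s xa[OF z] mus far[OF z]]
    have AA: "s + \<mu> * (x z - a) \<le> y z \<and> (y z = s + \<mu> * (x z - a) \<longrightarrow> x z = a \<and> y z = s \<or> x z = - 1 / (1 + r) \<and> y z = 0)"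
      if "0 \<le> y z" using A that by blast
    show "0 \<le> t z" using AA B(1) by (auto simp: t_def \<sigma>_def algebra_simps)
    assume t: "t z = 0"
    show "x z = a \<and> \<bar>y z\<bar> = s \<or> x z = - 1 / (1 + r) \<and> y z = 0"
    proof (cases "0 \<le> y z")
      case True
      with t have "y z = s + \<mu> * (x z - a)" by (simp add: t_def \<sigma>_def)
      with AA[OF True] s show ?thesis by auto
    next
      case False
      with t have "\<bar>y z\<bar> = s + \<mu> * (a - x z)" by (simp add: t_def \<sigma>_def algebra_simps)
      with B(2) show ?thesis by blast
    qed
  qed
  \<comment> \<open>The signed count is twice the upper count minus the total, so at least
    \<open>2 * (m + 1) - (2 * m + 1) = 1\<close>.\<close>
  have "(\<Sum>z\<in>Z. real (N z) * \<sigma> z) =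
      (\<Sum>z\<in>Z. 2 * (if 0 \<le> y z then real (N z) else 0) - real (N z))"
    by (intro sum.cong) (auto simp: \<sigma>_def)
  also have "\<dots> = 2 * (\<Sum>z | z \<in> Z \<and> 0 \<le> y z. real (N z)) - (\<Sum>z\<in>Z. real (N z))"
    using fin by (simp add: sum_subtractf sum_distrib_left[symmetric] sum.If_cases Int_def)
  also have "\<dots> \<ge> 1"
  proof -
    have "real (m + 1) \<le> real (\<Sum>z | z \<in> Z \<and> 0 \<le> y z. N z)"
      using upper of_nat_le_iff by blast
    moreover have "real (\<Sum>z\<in>Z. N z) = 2 * real m + 1" using card by simp
    ultimately show ?thesis by simp
  qed
  finally have sig: "1 \<le> (\<Sum>z\<in>Z. real (N z) * \<sigma> z)" .
  have "(\<Sum>z\<in>Z. real (N z) * t z) =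
      (\<Sum>z\<in>Z. real (N z) * y z - \<mu> * (real (N z) * x z) + \<mu> * a * real (N z) - s * (real (N z) * \<sigma> z))"
    by (intro sum.cong) (auto simp: t_def algebra_simps)
  also have "\<dots> = \<mu> * a * (\<Sum>z\<in>Z. real (N z)) - s * (\<Sum>z\<in>Z. real (N z) * \<sigma> z)"
    using sumx sumy by (simp add: sum_subtractf sum.distrib sum_distrib_left[symmetric])
  also have "(\<Sum>z\<in>Z. real (N z)) = 2 * real m + 1"
    using card by (metis of_nat_sum of_nat_Suc Suc_eq_plus1 of_nat_mult of_nat_numeral add.commute)
  finally have total: "(\<Sum>z\<in>Z. real (N z) * t z) = \<mu> * a * (2 * real m + 1) - s * (\<Sum>z\<in>Z. real (N z) * \<sigma> z)" .
  \<comment> \<open>Writing \<open>s\<close> as a multiple of \<open>\<mu>\<close> exposes the sign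
    of the total: of the \<open>2 * m + 1\<close> copies of \<open>\<mu> * a\<close> one cancels,
    leaving \<open>\<mu> * (2 * m * a - 1 / (1 + r))\<close>.\<close>
  have s_mu: "s = \<mu> * (a + 1 / (1 + r))" using den by (simp add: \<mu>_def)
  have balance: "\<mu> * a * (2 * real m + 1) - s = \<mu> * (2 * real m * (1 + r) * a - 1) / (1 + r)"
    unfolding s_mu using r by (simp add: field_simps)
  have "s * 1 \<le> s * (\<Sum>z\<in>Z. real (N z) * \<sigma> z)" by (rule mult_left_mono[OF sig]) (use s in simp)
  then have le: "(\<Sum>z\<in>Z. real (N z) * t z) \<le> \<mu> * (2 * real m * (1 + r) * a - 1) / (1 + r)"
    using total balance by linarith
  have nonneg: "0 \<le> (\<Sum>z\<in>Z. real (N z) * t z)" using t0 by (simp add: sum_nonneg)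
  with le have "0 \<le> \<mu> * (2 * real m * (1 + r) * a - 1) / (1 + r)" by linarith
  then have am_eq: "2 * real m * (1 + r) * a = 1"
    using mu0 r am by (simp add: zero_le_divide_iff zero_le_mult_iff)
  with le nonneg have "(\<Sum>z\<in>Z. real (N z) * t z) = 0" by simp
  then have "\<forall>z\<in>Z. real (N z) * t z = 0"
    using fin t0 by (subst (asm) sum_nonneg_eq_0_iff) auto
  then have "\<forall>z\<in>Z. t z = 0" using Npos by force
  then show ?thesis using am_eq t_eq by blast
qed

text \<open>The closed half-planes \<open>y \<ge> 0\<close> and \<open>y \<le> 0\<close> cover all
  \<open>2 * m + 1\<close> points, so one of them holds at least \<open>m + 1\<close>; all other
  hypotheses are invariant under \<open>y \<mapsto> - y\<close>.\<close>

lemma odd_configuration: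
  fixes N :: "'a \<Rightarrow> nat" and x y :: "'a \<Rightarrow> real"
  assumes fin: "finite Z" and Npos: "\<And>z. z \<in> Z \<Longrightarrow> 0 < N z"
    and card: "(\<Sum>z\<in>Z. N z) = 2 * m + 1"
    and sumx: "(\<Sum>z\<in>Z. real (N z) * x z) = 0" and sumy: "(\<Sum>z\<in>Z. real (N z) * y z) = 0"
    and r: "0 < r" "r < 1" and m: "1 \<le> m" and s: "0 < s" and a0: "0 \<le> a"
    and E: "(1 - r\<^sup>2) * (a\<^sup>2 + s\<^sup>2) = 1 + 2 * r * a"
    and am: "2 * real m * (1 + r) * a \<le> 1"
    and in_disk: "\<And>z. z \<in> Z \<Longrightarrow> 1 + 2 * r * x z \<le> (1 - r\<^sup>2) * ((x z)\<^sup>2 + (y z)\<^sup>2)"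
    and far: "\<And>z. z \<in> Z \<Longrightarrow> (x z)\<^sup>2 + (y z)\<^sup>2 \<le> a\<^sup>2 + s\<^sup>2"
  shows "2 * real m * (1 + r) * a = 1 \<and>
    (\<forall>z\<in>Z. x z = a \<and> \<bar>y z\<bar> = s \<or> x z = - 1 / (1 + r) \<and> y z = 0)"
proof (cases "m + 1 \<le> (\<Sum>z | z \<in> Z \<and> 0 \<le> y z. N z)")
  case True
  then show ?thesis
    using odd_configuration_upper[where N = N and x = x and y = y] assms by blast
next
  case False
  let ?U = "{z \<in> Z. 0 \<le> y z}" and ?L = "{z \<in> Z. 0 \<le> - y z}"
  have "(\<Sum>z\<in>Z. N z) \<le> (\<Sum>z\<in>?U \<union> ?L. N z)" using fin by (intro sum_mono2) auto
  also have "\<dots> \<le> (\<Sum>z\<in>?U. N z) + (\<Sum>z\<in>?L. N z)" using fin by (simp add: sum_Un_nat)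
  finally have "m + 1 \<le> (\<Sum>z\<in>?L. N z)" using False card by linarith
  moreover have "(\<Sum>z\<in>Z. real (N z) * - y z) = 0" using sumy by (simp add: sum_negf)
  ultimately show ?thesis
    using odd_configuration_upper[where N = N and x = x and y = "\<lambda>z. - y z" and Z = Z
        and m = m and r = r and s = s and a = a] assms by simp
qed

section \<open>Critical points and distances to the zeros\<close>

text \<open>This is the vanishing of the logarithmic derivative \<open>p' / p\<close> at
  \<open>w\<close>, obtained by applying the product rule to the factorisation of \<open>p\<close>
  into powers of linear factors.\<close>

lemma critical_point_order_sum:
  fixes p :: "complex poly"
  assumes crit: "critical_point p w" and nz: "poly p w \<noteq> 0"
  shows "(\<Sum>z\<in>zeros p. of_nat (order z p) / (z - w)) = 0"
proof -
  let ?Z = "zeros p" and ?f = "\<lambda>z. [:-z, 1:] ^ order z p"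
  have "p \<noteq> 0" using nz by auto
  then have fin: "finite ?Z" by (auto simp: zeros_def poly_roots_finite)
  have nzw: "w - a \<noteq> 0" if "a \<in> ?Z" for a using that nz by (auto simp: zeros_def)
  have p: "p = smult (lead_coeff p) (prod ?f ?Z)"
    by (simp add: zeros_def complex_poly_decompose)
  have summand: "poly (prod ?f (?Z - {a}) * pderiv (?f a)) w
      = poly (prod ?f ?Z) w * (of_nat (order a p) / (w - a))" if a: "a \<in> ?Z" for a
  proof -
    have "order a p \<noteq> 0" using a \<open>p \<noteq> 0\<close> by (simp add: zeros_def order_root)
    then obtain k where k: "order a p = Suc k" by (cases "order a p") auto
    have P: "poly (prod ?f ?Z) w = (w - a) * (w - a) ^ k * poly (prod ?f (?Z - {a})) w"
      unfolding prod.remove[OF fin a] poly_mult poly_power k by simp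
    have D: "poly (pderiv (?f a)) w = of_nat (order a p) * (w - a) ^ k"
      unfolding pderiv_power k by (simp add: pderiv_pCons poly_power)
    show ?thesis unfolding poly_mult P D using nzw[OF a] by simp
  qed
  have "0 = poly (pderiv (smult (lead_coeff p) (prod ?f ?Z))) w"
    using crit p unfolding critical_point_def by simp
  also have "\<dots> = lead_coeff p * (\<Sum>a\<in>?Z. poly (prod ?f ?Z) w * (of_nat (order a p) / (w - a)))"
    unfolding pderiv_smult poly_smult pderiv_prod poly_sum by (simp only: summand cong: sum.cong)
  also have "\<dots> = poly p w * (\<Sum>a\<in>?Z. of_nat (order a p) / (w - a))"
    by (subst (3) p) (simp add: sum_distrib_left mult.assoc)
  finally have "(\<Sum>a\<in>?Z. of_nat (order a p) / (w - a)) = 0" using nz by simp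
  moreover have "(\<Sum>a\<in>?Z. of_nat (order a p) / (a - w)) = - (\<Sum>a\<in>?Z. of_nat (order a p) / (w - a))"
    by (simp add: sum_negf[symmetric] minus_divide_right)
  ultimately show ?thesis by simp
qed

section \<open>Sums over zeros with multiplicity, and the distance to the zero set\<close>

lemma sum_order_zeros:
  assumes "p \<noteq> 0"
  shows "(\<Sum>z\<in>zeros p. order z p) = degree p"
proof -
  have "degree p = size (proots p)" by (simp add: size_proots_complex)
  also have "\<dots> = (\<Sum>z\<in>zeros p. order z p)"
    using assms by (simp add: size_multiset_overloaded_eq zeros_def)
  finally show ?thesis by simp
qed

lemma sum_mset_multiplicity:
  "sum_mset M = (\<Sum>z\<in>set_mset M. of_nat (count M z) * (z :: 'a :: comm_semiring_1))"
proof (induction M)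
  case (add x M)
  have "(\<Sum>z\<in>set_mset (add_mset x M). of_nat (count (add_mset x M) z) * z)
      = (\<Sum>z\<in>insert x (set_mset M). of_nat (count M z) * z + (if z = x then x else 0))"
    by (intro sum.cong) (auto simp: algebra_simps)
  also have "\<dots> = (\<Sum>z\<in>insert x (set_mset M). of_nat (count M z) * z) + x"
    by (simp add: sum.distrib)
  \<comment> \<open>If \<open>x\<close> does not occur in \<open>M\<close>, its term has count 0 and
    may be dropped.\<close>
  also have "(\<Sum>z\<in>insert x (set_mset M). of_nat (count M z) * z)
      = (\<Sum>z\<in>set_mset M. of_nat (count M z) * z)"
    by (intro sum.mono_neutral_right) (auto simp: not_in_iff)
  finally show ?case using add.IH by (simp add: add.commute)
qed simp

lemma sum_mset_proots:
  fixes p :: "complex poly"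
  assumes "p \<noteq> 0"
  shows "sum_mset (proots p) = (\<Sum>z\<in>zeros p. of_nat (order z p) * z)"
  using assms by (simp add: sum_mset_multiplicity zeros_def)

lemma admissible_nonzero: "admissible n p \<Longrightarrow> p \<noteq> 0"
  by (auto simp: admissible_def)

lemma finite_zeros: "p \<noteq> 0 \<Longrightarrow> finite (zeros p)"
  by (simp add: zeros_def poly_roots_finite)

lemma zeros_nonempty: "degree p > 0 \<Longrightarrow> zeros p \<noteq> {}"
  unfolding zeros_def using fundamental_theorem_of_algebra[of p] constant_degree[of p] by auto

lemma dist_zeros_le: "p \<noteq> 0 \<Longrightarrow> z \<in> zeros p \<Longrightarrow> dist_zeros w p \<le> cmod (z - w)"
  unfolding dist_zeros_def by (intro Min_le) (auto simp: finite_zeros)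

lemma dist_zeros_attained:
  assumes "degree p > 0"
  obtains z where "z \<in> zeros p" "dist_zeros w p = cmod (z - w)"
proof -
  have "p \<noteq> 0" using assms by auto
  have "dist_zeros w p \<in> (\<lambda>z. cmod (z - w)) ` zeros p"
    unfolding dist_zeros_def using assms \<open>p \<noteq> 0\<close>
    by (intro Min_in) (simp_all add: finite_zeros zeros_nonempty)
  then show ?thesis using that by auto
qed

lemma dist_zeros_eq_0_iff:
  assumes "degree p > 0"
  shows "dist_zeros w p = 0 \<longleftrightarrow> poly p w = 0"
proof
  assume "dist_zeros w p = 0"
  then show "poly p w = 0"
    using dist_zeros_attained[OF assms, of w] by (auto simp: zeros_def)
next
  assume "poly p w = 0"
  then have "w \<in> zeros p" by (simp add: zeros_def)
  moreover have "p \<noteq> 0" using assms by auto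
  ultimately have "dist_zeros w p \<le> 0" using dist_zeros_le[of p w w] by simp
  moreover have "dist_zeros w p \<ge> 0" using dist_zeros_attained[OF assms, of w] by (metis norm_ge_zero)
  ultimately show "dist_zeros w p = 0" by simp
qed

lemma O_bound_nonneg: "0 \<le> r \<Longrightarrow> r \<le> 1 \<Longrightarrow> 0 \<le> O_bound n r"
  by (cases "n = 0") (auto simp: O_bound_def)

text \<open>With \<open>n = 2 * m + 1\<close> the common factor 2 in the fraction cancels, and
  \<open>(1 + r)^2 * (1 - r) = (1 + r) * (1 - r^2)\<close>. Free of roots and quotients, this is the
  form in which the odd bound is compared with \<open>d^2\<close>.\<close>

lemma O_bound_square:
  assumes "0 \<le> r" "r \<le> 1" "1 \<le> m"
  shows "(O_bound (2 * m + 1) r)\<^sup>2 * (real m + (real m + 1) * r) = real m * (1 + r) * (1 - r\<^sup>2)"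
proof -
  have q: "0 < real m + (real m + 1) * r" using assms by (simp add: add_pos_nonneg)
  have eq: "(real (2 * m + 1) - 1) * (1 - r) / ((real (2 * m + 1) - 1) + (real (2 * m + 1) + 1) * r)
    = real m * (1 - r) / (real m + (real m + 1) * r)"
    using q by (simp add: divide_simps) (simp add: algebra_simps)
  have "0 \<le> real m * (1 - r) / (real m + (real m + 1) * r)" using q assms by simp
  then have "(O_bound (2 * m + 1) r)\<^sup>2 = (1 + r)\<^sup>2 * (real m * (1 - r) / (real m + (real m + 1) * r))"
    unfolding O_bound_def eq power_mult_distrib by (simp only: real_sqrt_pow2)
  then have "(O_bound (2 * m + 1) r)\<^sup>2 * (real m + (real m + 1) * r) = (1 + r)\<^sup>2 * (real m * (1 - r))"
    using q by simp
  then show ?thesis by (simp add: power2_eq_square algebra_simps)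
qed

section \<open>Reciprocals of the displacements from a critical point that is not a zero\<close>

locale critical_non_zero =
  fixes n :: nat and p :: "complex poly" and w :: complex
  assumes n_pos: "0 < n" and adm: "admissible n p" and crit: "critical_point p w"
    and nz: "poly p w \<noteq> 0"
begin

abbreviation "Z \<equiv> zeros p"
abbreviation "N z \<equiv> order z p"
definition "r = cmod w"
definition "d = dist_zeros w p"

text \<open>The unimodular factor \<open>c\<close> plays the role of rotating \<open>w\<close> to \<open>r \<ge> 0\<close>.\<close>

definition "c = (if w = 0 then 1 else sgn w)"
definition "u z = c / (z - w)"

lemma p_nonzero: "p \<noteq> 0" using adm by (rule admissible_nonzero)

lemma fin: "finite Z" using p_nonzero by (rule finite_zeros)

lemma degree_pos: "degree p > 0" using adm n_pos by (simp add: admissible_def)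

lemma N_pos: "z \<in> Z \<Longrightarrow> 0 < N z"
  using p_nonzero by (simp add: zeros_def order_root)

lemma sum_N: "(\<Sum>z\<in>Z. N z) = n"
  using sum_order_zeros[OF p_nonzero] adm by (simp add: admissible_def)

lemma sum_N_real: "(\<Sum>z\<in>Z. real (N z)) = real n"
  using sum_N by (metis of_nat_sum)

lemma c_w: "cmod c = 1" "w = of_real r * c"
  by (auto simp: c_def r_def norm_sgn) (simp add: sgn_eq)

lemma z_ne_w: "z \<in> Z \<Longrightarrow> z - w \<noteq> 0"
  using nz by (auto simp: zeros_def)

lemma u_nonzero: "z \<in> Z \<Longrightarrow> u z \<noteq> 0"
  using z_ne_w c_w(1) by (auto simp: u_def)

lemma z_eq: "z \<in> Z \<Longrightarrow> z = w + c / u z"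
  using z_ne_w c_w(1) by (auto simp: u_def)

lemma norm_u: "cmod (u z) = 1 / cmod (z - w)"
  using c_w(1) by (simp add: u_def norm_divide)

text \<open>Since \<open>z = c * (r + 1 / u z)\<close>, one has
  \<open>z * u z = c * (r * u z + 1)\<close>; taking moduli removes the unimodular
  \<open>c\<close>.\<close>

lemma norm_z:
  assumes "z \<in> Z"
  shows "(cmod z)\<^sup>2 * (cmod (u z))\<^sup>2 = r\<^sup>2 * (cmod (u z))\<^sup>2 + 2 * r * Re (u z) + 1"
proof -
  have "z * u z = c * (of_real r * u z + 1)"
    by (subst z_eq[OF assms], subst c_w(2)) (use u_nonzero[OF assms] in \<open>simp add: field_simps\<close>)
  then have "cmod (z * u z) = cmod (c * (of_real r * u z + 1))" by simp
  then have "cmod z * cmod (u z) = cmod (of_real r * u z + 1)"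
    using c_w(1) by (simp only: norm_mult mult_1)
  then have "(cmod z)\<^sup>2 * (cmod (u z))\<^sup>2 = (cmod (of_real r * u z + 1))\<^sup>2"
    by (simp flip: power_mult_distrib)
  then show ?thesis unfolding cmod_power2[of "u z"] cmod_power2[of "of_real r * u z + 1"]
    by (simp add: power2_eq_square algebra_simps)
qed

text \<open>The image of the unit disk under the inversion, written so that its linear term in
  \<open>Re (u z)\<close> disappears on summation, by \<open>sum_Re_u\<close>.\<close>

lemma u_in_disk:
  assumes "z \<in> Z"
  shows "1 + 2 * r * Re (u z) \<le> (1 - r\<^sup>2) * (cmod (u z))\<^sup>2"
proof -
  have "cmod z \<le> 1" using assms adm by (auto simp: admissible_def)
  then have "(cmod z)\<^sup>2 * (cmod (u z))\<^sup>2 \<le> 1 * (cmod (u z))\<^sup>2"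
    by (intro mult_right_mono) (auto simp: power_le_one)
  then show ?thesis using norm_z[OF assms] by (simp add: algebra_simps)
qed

lemma d_pos: "0 < d"
  using dist_zeros_attained[OF degree_pos, of w] z_ne_w unfolding d_def by (metis zero_less_norm_iff)

lemma d_le: "z \<in> Z \<Longrightarrow> d \<le> cmod (z - w)"
  unfolding d_def by (rule dist_zeros_le[OF p_nonzero])

lemma u_far:
  assumes "z \<in> Z"
  shows "(cmod (u z))\<^sup>2 \<le> 1 / d\<^sup>2"
proof -
  have "cmod (u z) \<le> 1 / d"
    unfolding norm_u using d_le[OF assms] d_pos z_ne_w[OF assms] by (intro divide_left_mono mult_pos_pos) auto
  then have "(cmod (u z))\<^sup>2 \<le> (1 / d)\<^sup>2" by (rule power_mono) simp
  then show ?thesis by (simp add: power_divide)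
qed

lemma sum_u: "(\<Sum>z\<in>Z. of_nat (N z) * u z) = 0"
proof -
  have "(\<Sum>z\<in>Z. of_nat (N z) * u z) = c * (\<Sum>z\<in>Z. of_nat (N z) / (z - w))"
    by (simp add: u_def sum_distrib_left mult_ac)
  then show ?thesis using critical_point_order_sum[OF crit nz] by simp
qed

lemma sum_Re_u: "(\<Sum>z\<in>Z. real (N z) * Re (u z)) = 0"
  using arg_cong[OF sum_u, of Re] by simp

lemma sum_Im_u: "(\<Sum>z\<in>Z. real (N z) * Im (u z)) = 0"
  using arg_cong[OF sum_u, of Im] by simp

lemma sum_disk: "real n \<le> (1 - r\<^sup>2) * (\<Sum>z\<in>Z. real (N z) * (cmod (u z))\<^sup>2)"
proof -
  have "real n = (\<Sum>z\<in>Z. real (N z) * (1 + 2 * r * Re (u z)))"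
  proof -
    have "(\<Sum>z\<in>Z. real (N z) * (1 + 2 * r * Re (u z))) =
      (\<Sum>z\<in>Z. real (N z) + 2 * r * (real (N z) * Re (u z)))" by (intro sum.cong) (auto simp: algebra_simps)
    then show ?thesis using sum_Re_u by (simp add: sum.distrib sum_distrib_left[symmetric] sum_N_real)
  qed
  also have "\<dots> \<le> (\<Sum>z\<in>Z. real (N z) * ((1 - r\<^sup>2) * (cmod (u z))\<^sup>2))"
    by (intro sum_mono mult_left_mono u_in_disk) auto
  finally show ?thesis by (simp add: sum_distrib_left mult_ac)
qed

lemma sum_far: "(\<Sum>z\<in>Z. real (N z) * (cmod (u z))\<^sup>2) \<le> real n / d\<^sup>2"
proof -
  have "(\<Sum>z\<in>Z. real (N z) * (cmod (u z))\<^sup>2) \<le> (\<Sum>z\<in>Z. real (N z) * (1 / d\<^sup>2))"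
    by (intro sum_mono mult_left_mono u_far) auto
  then show ?thesis by (simp add: sum_divide_distrib[symmetric] sum_N_real)
qed

lemma r_range: "0 \<le> r" "r < 1" "0 < 1 - r\<^sup>2"
proof -
  show "0 \<le> r" by (simp add: r_def)
  \<comment> \<open>A positive product with a nonnegative second factor has a positive first factor.
    This excludes \<open>r \<ge> 1\<close> without appeal to the Gauss-Lucas theorem.\<close>
  have "0 < (1 - r\<^sup>2) * (\<Sum>z\<in>Z. real (N z) * (cmod (u z))\<^sup>2)" using sum_disk n_pos by linarith
  moreover have "0 \<le> (\<Sum>z\<in>Z. real (N z) * (cmod (u z))\<^sup>2)" by (simp add: sum_nonneg)
  ultimately show *: "0 < 1 - r\<^sup>2" by (simp add: zero_less_mult_iff)
  show "r < 1" using * abs_square_less_1[of r] by simp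
qed

text \<open>Both constraints are summed:
  \<open>n \<le> (1 - r^2) * \<Sigma> \<le> (1 - r^2) * n / d^2\<close>, where
  \<open>\<Sigma>\<close> is the weighted sum of the \<open>\<bar>u z\<bar>^2\<close>. Parity does
  not enter.\<close>

lemma d_square_le: "d\<^sup>2 \<le> 1 - r\<^sup>2"
proof -
  have "real n \<le> (1 - r\<^sup>2) * (real n / d\<^sup>2)"
    using sum_disk mult_left_mono[OF sum_far, of "1 - r\<^sup>2"] r_range(3) by linarith
  then have "real n * d\<^sup>2 \<le> real n * (1 - r\<^sup>2)" using d_pos by (simp add: field_simps)
  then show ?thesis using n_pos by simp
qed

lemma d_le_E_bound: "d \<le> E_bound r"
  unfolding E_bound_def by (rule real_le_rsqrt[OF d_square_le])

text \<open>Equality in the chain for \<open>d_square_le\<close> makes the summed inequality tight,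
  so each \<open>u_far\<close> is tight. The disk constraint then reads
  \<open>r * Re (u z) \<le> 0\<close>, and these terms have weighted sum zero.\<close>

lemma E_equality:
  assumes d: "d\<^sup>2 = 1 - r\<^sup>2" and z: "z \<in> Z"
  shows "(cmod (u z))\<^sup>2 = 1 / d\<^sup>2" and "r * Re (u z) = 0"
proof -
  have eq: "(\<Sum>z\<in>Z. real (N z) * (cmod (u z))\<^sup>2) = real n / d\<^sup>2"
    using sum_far sum_disk r_range(3) unfolding d by (simp add: field_simps)
  have "(\<Sum>z\<in>Z. real (N z) * (1 / d\<^sup>2 - (cmod (u z))\<^sup>2)) = 0"
  proof -
    have "(\<Sum>z\<in>Z. real (N z) * (1 / d\<^sup>2 - (cmod (u z))\<^sup>2))
      = (\<Sum>z\<in>Z. real (N z) / d\<^sup>2 - real (N z) * (cmod (u z))\<^sup>2)"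
      by (intro sum.cong) (auto simp: algebra_simps)
    then show ?thesis using eq by (simp add: sum_subtractf sum_divide_distrib[symmetric] sum_N_real)
  qed
  then have "\<forall>z\<in>Z. real (N z) * (1 / d\<^sup>2 - (cmod (u z))\<^sup>2) = 0"
    using u_far fin by (subst (asm) sum_nonneg_eq_0_iff) auto
  then have U: "(cmod (u z))\<^sup>2 = 1 / d\<^sup>2" if "z \<in> Z" for z using N_pos[OF that] that by force
  show "(cmod (u z))\<^sup>2 = 1 / d\<^sup>2" using U[OF z] .
  have le: "r * Re (u z) \<le> 0" if "z \<in> Z" for z
    using u_in_disk[OF that] U[OF that] d r_range(3) by simp
  have "(\<Sum>z\<in>Z. real (N z) * - (r * Re (u z))) = - r * (\<Sum>z\<in>Z. real (N z) * Re (u z))"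
    by (simp add: sum_distrib_left sum_negf mult_ac)
  then have "(\<Sum>z\<in>Z. real (N z) * - (r * Re (u z))) = 0" using sum_Re_u by simp
  then have "\<forall>z\<in>Z. real (N z) * - (r * Re (u z)) = 0"
    using fin le by (subst (asm) sum_nonneg_eq_0_iff) (auto simp: mult_nonneg_nonpos)
  then show "r * Re (u z) = 0" using N_pos[OF z] z by force
qed

text \<open>For \<open>r > 0\<close>, \<open>a\<close> and \<open>s\<close> are the coordinates of
  the intersection points \<open>a \<plusminus> i s\<close> of the circles on which
  \<open>u_far\<close> and \<open>u_in_disk\<close> are tight: \<open>a\<close> solves
  \<open>1 + 2 * r * a = (1 - r^2) / d^2\<close>. That the root defining \<open>s\<close> has a
  positive argument is established in \<open>odd_dichotomy\<close>.\<close>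

definition "a = ((1 - r\<^sup>2) / d\<^sup>2 - 1) / (2 * r)"
definition "s = sqrt (1 / d\<^sup>2 - a\<^sup>2)"

text \<open>By \<open>O_bound_square\<close>, \<open>2 * m * (1 + r) * a - 1\<close> is a positive
  multiple of the squared bound minus \<open>d^2\<close>; this translates the hypothesis and
  conclusion of \<open>odd_configuration\<close> into statements about the distance.\<close>

lemma a_compare:
  assumes "0 < r" "1 \<le> m"
  shows "2 * real m * (1 + r) * a \<le> 1 \<longleftrightarrow> (O_bound (2 * m + 1) r)\<^sup>2 \<le> d\<^sup>2"
    and "2 * real m * (1 + r) * a = 1 \<longleftrightarrow> d\<^sup>2 = (O_bound (2 * m + 1) r)\<^sup>2"
proof -
  let ?q = "real m + (real m + 1) * r" and ?O = "(O_bound (2 * m + 1) r)\<^sup>2"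
  have q: "0 < ?q" using assms by (simp add: add_pos_pos)
  have "2 * real m * (1 + r) * a - 1 = (real m * (1 + r) * (1 - r\<^sup>2) - ?q * d\<^sup>2) / (r * d\<^sup>2)"
    unfolding a_def using assms d_pos by (simp add: field_simps)
  also have "real m * (1 + r) * (1 - r\<^sup>2) = ?O * ?q"
    by (rule O_bound_square[symmetric]) (use assms r_range in auto)
  finally have *: "2 * real m * (1 + r) * a - 1 = ?q / (r * d\<^sup>2) * (?O - d\<^sup>2)"
    by (simp add: algebra_simps)
  have pos: "0 < ?q / (r * d\<^sup>2)" using q assms d_pos by simp
  have "2 * real m * (1 + r) * a - 1 \<le> 0 \<longleftrightarrow> ?O - d\<^sup>2 \<le> 0"
    unfolding * using pos by (simp only: mult_le_0_iff) linarith
  then show "2 * real m * (1 + r) * a \<le> 1 \<longleftrightarrow> ?O \<le> d\<^sup>2" by simp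
  have "2 * real m * (1 + r) * a - 1 = 0 \<longleftrightarrow> ?O - d\<^sup>2 = 0"
    unfolding * using pos by (simp only: mult_eq_0_iff) linarith
  then show "2 * real m * (1 + r) * a = 1 \<longleftrightarrow> d\<^sup>2 = ?O" by auto
qed

text \<open>Supposing that \<open>d\<close> reaches the bound gives \<open>am\<close>, so
  \<open>odd_configuration\<close> applies: \<open>d\<close> cannot exceed the bound, and the
  possible values of \<open>u z\<close> are determined.\<close>

lemma odd_dichotomy:
  assumes n: "n = 2 * m + 1" and m: "1 \<le> m" and r0: "0 < r" and O: "O_bound n r \<le> d"
  shows "d = O_bound n r" and "2 * real m * (1 + r) * a = 1" and "0 < s" and "a\<^sup>2 + s\<^sup>2 = 1 / d\<^sup>2"
    and "\<And>z. z \<in> Z \<Longrightarrow> Re (u z) = a \<and> \<bar>Im (u z)\<bar> = s \<or> Re (u z) = - 1 / (1 + r) \<and> Im (u z) = 0"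
proof -
  have O0: "0 \<le> O_bound n r" using O_bound_nonneg r_range by simp
  then have "(O_bound n r)\<^sup>2 \<le> d\<^sup>2" using O by (simp add: power_mono)
  then have am: "2 * real m * (1 + r) * a \<le> 1" using a_compare(1)[OF r0 m] n by simp
  have a0: "0 \<le> a" unfolding a_def using d_square_le d_pos r0 by simp
  \<comment> \<open>From \<open>am\<close> one gets \<open>a \<le> 1/2\<close>, hence
    \<open>a^2 < 1 \<le> 1 / d^2\<close>, so the two circles meet off the real axis.\<close>
  have "1 * (2 * a) \<le> real m * (1 + r) * (2 * a)"
    using m r0 a0 mult_mono[of 1 "real m" 1 "1 + r"] by (intro mult_right_mono) auto
  then have "a \<le> 1 / 2" using am by simp
  then have "a\<^sup>2 \<le> (1 / 2)\<^sup>2" using a0 by (rule power_mono)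
  moreover have "d\<^sup>2 \<le> 1" using d_square_le zero_le_power2[of r] by linarith
  then have "1 \<le> 1 / d\<^sup>2" using d_pos by simp
  ultimately have gap: "0 < 1 / d\<^sup>2 - a\<^sup>2" by (simp add: power2_eq_square)
  then show s0: "0 < s" by (simp add: s_def)
  show as: "a\<^sup>2 + s\<^sup>2 = 1 / d\<^sup>2" using gap by (simp add: s_def)
  have E: "(1 - r\<^sup>2) * (a\<^sup>2 + s\<^sup>2) = 1 + 2 * r * a"
    unfolding as using r0 by (simp add: a_def)
  have disk: "1 + 2 * r * Re (u z) \<le> (1 - r\<^sup>2) * ((Re (u z))\<^sup>2 + (Im (u z))\<^sup>2)" if "z \<in> Z" for z
    using u_in_disk[OF that] by (simp add: cmod_power2)
  have far: "(Re (u z))\<^sup>2 + (Im (u z))\<^sup>2 \<le> a\<^sup>2 + s\<^sup>2" if "z \<in> Z" for z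
    using u_far[OF that] as by (simp add: cmod_power2)
  have "(\<Sum>z\<in>Z. N z) = 2 * m + 1" using sum_N n by simp
  note conf = odd_configuration[OF fin N_pos this sum_Re_u sum_Im_u r0 r_range(2) m s0 a0 E am disk far]
  then show am_eq: "2 * real m * (1 + r) * a = 1" by blast
  then have "d\<^sup>2 = (O_bound n r)\<^sup>2" using a_compare(2)[OF r0 m] n by simp
  then show "d = O_bound n r" using O0 d_pos by (simp add: power2_eq_iff_nonneg)
  show "Re (u z) = a \<and> \<bar>Im (u z)\<bar> = s \<or> Re (u z) = - 1 / (1 + r) \<and> Im (u z) = 0" if "z \<in> Z" for z
    using conf that by blast
qed

lemma d_le_O_bound:
  assumes n: "n = 2 * m + 1" and m: "1 \<le> m"
  shows "d \<le> O_bound n r"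
\<comment> \<open>At \<open>r = 0\<close> the quotient defining \<open>a\<close> degenerates, but
  there the bound is 1 and \<open>d_square_le\<close> suffices.\<close>
proof (cases "r = 0")
  case True
  then have "d\<^sup>2 \<le> 1\<^sup>2" using d_square_le by simp
  then have "d \<le> 1" by (rule power2_le_imp_le) simp
  then show ?thesis using True n m by (simp add: O_bound_def)
next
  case False
  then have "0 < r" using r_range by simp
  then show ?thesis using odd_dichotomy(1)[OF n m] by fastforce
qed

text \<open>Points outside \<open>Z\<close> have order 0 and contribute a factor 1. Hence explicit
  candidate sets can be used before it is known which candidates really are zeros.\<close>

lemma poly_eq_prod:
  assumes "finite S" "Z \<subseteq> S"
  shows "p = (\<Prod>z\<in>S. [:-z, 1:] ^ N z)"
proof -
  have "p = (\<Prod>z\<in>Z. [:-z, 1:] ^ N z)"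
    using complex_poly_decompose[of p] adm unfolding zeros_def admissible_def by (metis smult_1_left)
  also have "\<dots> = (\<Prod>z\<in>S. [:-z, 1:] ^ N z)"
    using assms by (intro prod.mono_neutral_left) (auto simp: zeros_def order_0I)
  finally show ?thesis .
qed

lemma sum_N_superset:
  fixes f :: "complex \<Rightarrow> real"
  assumes "finite S" "Z \<subseteq> S"
  shows "(\<Sum>z\<in>Z. real (N z) * f z) = (\<Sum>z\<in>S. real (N z) * f z)"
  using assms by (intro sum.mono_neutral_left) (auto simp: zeros_def order_0I)

end

section \<open>Extremal polynomials\<close>

text \<open>For \<open>c = cos \<phi>\<close> this is the product of the linear factors with roots
  \<open>cis \<phi>\<close> and \<open>cis (- \<phi>)\<close>.\<close>

definition quad :: "real \<Rightarrow> complex poly" where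
  "quad c = [:1, - 2 * of_real c, 1:]"

lemma even_extremal_quad:
  assumes "0 \<le> r" "r \<le> 1"
  shows "even_extremal m r = quad r ^ m"
proof -
  have "(of_real (sqrt (1 - r\<^sup>2)))\<^sup>2 = (of_real (1 - r\<^sup>2) :: complex)"
    using assms by (simp add: power_le_one flip: of_real_power)
  then have "[:- (complex_of_real r + \<i> * of_real (sqrt (1 - r\<^sup>2))), 1:] *
      [:- (complex_of_real r - \<i> * of_real (sqrt (1 - r\<^sup>2))), 1:] = quad r"
    by (simp add: quad_def algebra_simps power2_eq_square)
  then show ?thesis by (simp add: even_extremal_def flip: power_mult_distrib)
qed

lemma odd_extremal_quad: "odd_extremal m \<theta> = [:1, 1:] * quad (cos \<theta>) ^ m"
proof -
  have "cis \<theta> + cis (- \<theta>) = 2 * of_real (cos \<theta>)" by (simp add: complex_eq_iff)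
  then have "[:- cis \<theta>, 1:] * [:- cis (- \<theta>), 1:] = quad (cos \<theta>)"
    by (simp add: quad_def cis_mult algebra_simps)
  then show ?thesis unfolding odd_extremal_def mult.assoc power_mult_distrib[symmetric] by simp
qed

lemma degree_quad [simp]: "degree (quad c) = 2" "coeff (quad c) 2 = 1"
  by (simp_all add: quad_def numeral_2_eq_2)

lemma poly_pderiv_quad: "poly (pderiv (quad c)) z = 2 * (z - of_real c)"
  by (simp add: quad_def pderiv_pCons algebra_simps)

lemma poly_quad: "poly (quad c) z = 1 - 2 * of_real c * z + z\<^sup>2"
  by (simp add: quad_def algebra_simps power2_eq_square)

lemma even_extremal_attains:
  assumes r: "0 \<le> r" "r \<le> 1" and m: "1 \<le> m"
  shows "admissible (2 * m) (even_extremal m r)"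
    and "critical_point (even_extremal m r) (of_real r)"
    and "dist_zeros (of_real r) (even_extremal m r) = E_bound r"
proof -
  define s where "s = sqrt (1 - r\<^sup>2)"
  have s: "0 \<le> s" "r\<^sup>2 + s\<^sup>2 = 1" using r by (auto simp: s_def power_le_one)
  have Z: "zeros (even_extremal m r) = {of_real r + \<i> * of_real s, of_real r - \<i> * of_real s}"
    using m by (auto simp: zeros_def even_extremal_def s_def algebra_simps add_eq_0_iff)
  have n1: "cmod (of_real r + \<i> * of_real s) = 1" "cmod (of_real r - \<i> * of_real s) = 1"
    using s(2) by (simp_all add: cmod_def)
  have "lead_coeff (quad r ^ m) = 1" unfolding lead_coeff_power by simp
  moreover have "degree (quad r ^ m) = 2 * m"
    by (subst degree_power_eq) (auto simp: quad_def)
  moreover have "zeros (even_extremal m r) \<subseteq> cball 0 1" using n1 by (simp add: Z)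
  ultimately show "admissible (2 * m) (even_extremal m r)"
    unfolding admissible_def even_extremal_quad[OF r] by simp
  \<comment> \<open>The point \<open>r\<close> is the midpoint of the two zeros, where
    \<open>pderiv (quad r)\<close> vanishes.\<close>
  show "critical_point (even_extremal m r) (of_real r)"
    using m by (simp add: critical_point_def even_extremal_quad[OF r] pderiv_power poly_pderiv_quad)
  show "dist_zeros (of_real r) (even_extremal m r) = E_bound r"
    using s by (simp add: dist_zeros_def Z norm_mult E_bound_def s_def)
qed

text \<open>The solution \<open>c\<close> of
  \<open>1 - 2 * c * r + r^2 + 2 * m * (1 + r) * (r - c) = 0\<close>, the condition that makes
  \<open>r\<close> a critical point of \<open>[:1, 1:] * quad c ^ m\<close>.\<close>

definition odd_cos :: "nat \<Rightarrow> real \<Rightarrow> real" where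
  "odd_cos m r = ((2 * real m + 1) * r\<^sup>2 + 2 * real m * r + 1) / (2 * (real m + (real m + 1) * r))"

lemma odd_cos_eq:
  assumes "0 \<le> r" "1 \<le> m"
  shows "2 * (real m + (real m + 1) * r) * odd_cos m r = (2 * real m + 1) * r\<^sup>2 + 2 * real m * r + 1"
proof -
  have "0 < real m + (real m + 1) * r" using assms by (simp add: add_pos_nonneg)
  then show ?thesis by (simp add: odd_cos_def)
qed

lemma odd_cos_range:
  assumes "0 \<le> r" "r \<le> 1" "1 \<le> m"
  shows "0 \<le> odd_cos m r" "odd_cos m r \<le> 1"
proof -
  have q: "0 < real m + (real m + 1) * r" using assms by (simp add: add_pos_nonneg)
  show "0 \<le> odd_cos m r" using assms by (simp add: odd_cos_def)
  \<comment> \<open>The factored numerator of \<open>1 - odd_cos m r\<close>.\<close>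
  have "0 \<le> (1 - r) * ((2 * real m + 1) * r + (2 * real m - 1))" using assms by simp
  then show "odd_cos m r \<le> 1" unfolding odd_cos_def using q
    by (simp add: algebra_simps power2_eq_square)
qed

text \<open>The left side is the squared distance from \<open>r\<close> to
  \<open>cis \<theta>\<close> when \<open>cos \<theta> = odd_cos m r\<close>.\<close>

lemma odd_cos_O_bound:
  assumes "0 \<le> r" "r \<le> 1" "1 \<le> m"
  shows "1 - 2 * r * odd_cos m r + r\<^sup>2 = (O_bound (2 * m + 1) r)\<^sup>2"
proof -
  let ?q = "real m + (real m + 1) * r"
  have q: "0 < ?q" using assms by (simp add: add_pos_nonneg)
  have "?q * (1 - 2 * r * odd_cos m r + r\<^sup>2) = ?q * (1 + r\<^sup>2) - r * (2 * ?q * odd_cos m r)"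
    by (simp add: algebra_simps)
  also have "\<dots> = real m * (1 + r) * (1 - r\<^sup>2)"
    unfolding odd_cos_eq[OF assms(1,3)] by (simp add: algebra_simps power2_eq_square)
  also have "\<dots> = ?q * (O_bound (2 * m + 1) r)\<^sup>2"
    using O_bound_square[OF assms] by (simp add: mult.commute)
  finally show ?thesis using q by simp
qed

lemma odd_extremal_attains:
  assumes r: "0 \<le> r" "r \<le> 1" and m: "1 \<le> m" and \<theta>: "cos \<theta> = odd_cos m r"
  shows "admissible (2 * m + 1) (odd_extremal m \<theta>)"
    and "critical_point (odd_extremal m \<theta>) (of_real r)"
    and "dist_zeros (of_real r) (odd_extremal m \<theta>) = O_bound (2 * m + 1) r"
proof -
  have Z: "zeros (odd_extremal m \<theta>) = {- 1, cis \<theta>, cis (- \<theta>)}"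
    unfolding zeros_def odd_extremal_def poly_mult poly_power mult_eq_0_iff power_eq_0_iff
    using m by (auto simp: add_eq_0_iff)
  have deg: "degree (odd_extremal m \<theta>) = 2 * m + 1"
    unfolding odd_extremal_quad by (subst degree_mult_eq) (auto simp: quad_def degree_power_eq)
  have "lead_coeff (odd_extremal m \<theta>) = 1"
    unfolding odd_extremal_quad lead_coeff_mult lead_coeff_power by simp
  with deg show "admissible (2 * m + 1) (odd_extremal m \<theta>)"
    by (simp add: admissible_def Z)
  let ?c = "odd_cos m r"
  \<comment> \<open>This is the cofactor of \<open>quad ?c ^ (m - 1)\<close> in the derivative at
    \<open>r\<close>.\<close>
  have "1 - 2 * ?c * r + r\<^sup>2 + 2 * real m * (1 + r) * (r - ?c) = 0"
    using odd_cos_eq[OF r(1) m] by (simp add: algebra_simps power2_eq_square)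
  then have crit: "1 - 2 * of_real ?c * of_real r + (of_real r)\<^sup>2
      + 2 * of_nat m * (1 + of_real r) * (of_real r - of_real ?c) = (0 :: complex)"
    by (metis (mono_tags, opaque_lifting) of_real_0 of_real_1 of_real_add of_real_diff of_real_mult
        of_real_numeral of_real_of_nat_eq of_real_power)
  obtain k where k: "m = Suc k" using m by (cases m) auto
  have "poly (pderiv (odd_extremal m \<theta>)) (of_real r) = poly (quad ?c) (of_real r) ^ k *
      (1 - 2 * of_real ?c * of_real r + (of_real r)\<^sup>2
        + 2 * of_nat m * (1 + of_real r) * (of_real r - of_real ?c))"
    unfolding odd_extremal_quad \<theta> pderiv_mult pderiv_power
    by (simp add: poly_pderiv_quad poly_quad k pderiv_pCons algebra_simps)
  then show "critical_point (odd_extremal m \<theta>) (of_real r)"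
    unfolding critical_point_def crit by simp
  have dist: "cmod (cis \<phi> - of_real r) = O_bound (2 * m + 1) r" if "cos \<phi> = odd_cos m r" for \<phi>
  proof -
    have "(cmod (cis \<phi> - of_real r))\<^sup>2 = (cos \<phi>)\<^sup>2 + (sin \<phi>)\<^sup>2 - 2 * r * cos \<phi> + r\<^sup>2"
      unfolding cmod_power2 by (simp add: power2_eq_square algebra_simps)
    also have "\<dots> = (O_bound (2 * m + 1) r)\<^sup>2"
      using odd_cos_O_bound[OF r m] sin_cos_squared_add[of \<phi>] that by (simp add: add.commute)
    finally show ?thesis using O_bound_nonneg[OF r] by (simp add: power2_eq_iff_nonneg)
  qed
  have one: "cmod (- 1 - of_real r) = 1 + r"
  proof -
    have "- 1 - complex_of_real r = of_real (- (1 + r))" by simp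
    then show ?thesis using r by (simp only: norm_of_real)
  qed
  \<comment> \<open>The zero \<open>- 1\<close>, at distance \<open>1 + r\<close>, is no nearer than
    the conjugate pair, because \<open>odd_cos m r\<close> is nonnegative.\<close>
  have "(O_bound (2 * m + 1) r)\<^sup>2 \<le> (1 + r)\<^sup>2"
    using odd_cos_O_bound[OF r m] mult_nonneg_nonneg[OF r(1) odd_cos_range(1)[OF r m]] r
    by (simp add: power2_eq_square algebra_simps)
  then have "O_bound (2 * m + 1) r \<le> 1 + r" by (rule power2_le_imp_le) (use r in simp)
  then have Min_eq: "Min {1 + r, O_bound (2 * m + 1) r} = O_bound (2 * m + 1) r"
    by (subst Min_insert) (auto simp: min_def)
  have "cmod (cis (- \<theta>) - of_real r) = O_bound (2 * m + 1) r"
    by (rule dist) (simp add: \<theta>)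
  then have "(\<lambda>z. cmod (z - of_real r)) ` {- 1, cis \<theta>, cis (- \<theta>)} = {1 + r, O_bound (2 * m + 1) r}"
    by (simp only: image_insert image_empty one dist[OF \<theta>] insert_absorb2)
  then show "dist_zeros (of_real r) (odd_extremal m \<theta>) = O_bound (2 * m + 1) r"
    unfolding dist_zeros_def Z by (simp only: Min_eq)
qed

section \<open>Uniqueness of the extremal polynomials for a positive critical point\<close>

context critical_non_zero
begin

lemma c_if_real:
  assumes "w = of_real r" "0 < r"
  shows "c = 1"
proof -
  have "of_real r * c = of_real r * 1" using c_w(2) assms(1) by (metis mult.right_neutral)
  then show ?thesis using assms(2) by simp
qed

lemma u_if_real: "w = of_real r \<Longrightarrow> 0 < r \<Longrightarrow> u z = 1 / (z - of_real r)"
  using c_if_real u_def by metis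

lemma z_eq_if_real: "w = of_real r \<Longrightarrow> 0 < r \<Longrightarrow> z \<in> Z \<Longrightarrow> z = of_real r + 1 / u z"
  using c_if_real z_eq by metis

text \<open>By \<open>E_equality\<close> every \<open>u z\<close> is purely imaginary of modulus
  \<open>1 / t\<close>, which leaves two conjugate candidates for zeros; the vanishing sum of
  imaginary parts gives them equal multiplicity.\<close>

lemma even_equality:
  assumes w: "w = of_real r" and r0: "0 < r" and d: "d = E_bound r"
  shows "p = even_extremal (n div 2) r"
proof -
  define t where "t = sqrt (1 - r\<^sup>2)"
  have t: "0 < t" "t\<^sup>2 = 1 - r\<^sup>2" using r_range by (auto simp: t_def)
  have d2: "d\<^sup>2 = 1 - r\<^sup>2" "d = t" using d t by (auto simp: E_bound_def t_def)
  note u_eq = u_if_real[OF w r0] and z_eq' = z_eq_if_real[OF w r0]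
  let ?e = "complex_of_real r + \<i> * of_real t" and ?e' = "complex_of_real r - \<i> * of_real t"
  have Im_t: "Im (u z) = 1 / t \<or> Im (u z) = - (1 / t)" and Re_0: "Re (u z) = 0" if "z \<in> Z" for z
  proof -
    show "Re (u z) = 0" using E_equality(2)[OF d2(1) that] r0 by simp
    then have "(Im (u z))\<^sup>2 = (1 / t)\<^sup>2"
      using E_equality(1)[OF d2(1) that] d2(2) by (simp add: cmod_power2 power_divide)
    then show "Im (u z) = 1 / t \<or> Im (u z) = - (1 / t)" by (simp add: power2_eq_iff)
  qed
  have ZS: "Z \<subseteq> {?e, ?e'}"
  proof
    fix z assume z: "z \<in> Z"
    have "u z = - (\<i> / of_real t) \<or> u z = \<i> / of_real t"
      using Im_t[OF z] Re_0[OF z] by (auto simp: complex_eq_iff Im_divide_of_real Re_divide_of_real)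
    then have "1 / u z = \<i> * of_real t \<or> 1 / u z = - \<i> * of_real t"
      by auto
    then show "z \<in> {?e, ?e'}" using z_eq'[OF z] by auto
  qed
  have ue: "Im (u ?e) = - 1 / t" "Im (u ?e') = 1 / t"
    using t(1) by (simp_all add: u_eq Im_divide power2_eq_square)
  have ne: "?e \<noteq> ?e'" using t(1) by (simp add: complex_eq_iff)
  have "(\<Sum>z\<in>{?e, ?e'}. real (N z) * Im (u z)) = 0"
    using sum_N_superset[OF _ ZS] sum_Im_u by simp
  then have NN: "N ?e = N ?e'" using ue ne t(1) by (simp add: field_simps)
  have "(\<Sum>z\<in>{?e, ?e'}. real (N z) * 1) = real n"
    using sum_N_superset[OF _ ZS, of "\<lambda>_. 1"] sum_N_real by simp
  then have n: "n = 2 * N ?e" using ne NN by simp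
  have "p = [:- ?e, 1:] ^ N ?e * [:- ?e', 1:] ^ N ?e'"
    using poly_eq_prod[OF _ ZS] ne by simp
  then show "p = even_extremal (n div 2) r"
    using n NN by (simp add: even_extremal_def t_def)
qed

text \<open>The candidates are \<open>e\<close>, \<open>cnj e\<close> and \<open>- 1\<close>. Three
  linear relations fix their multiplicities: the imaginary sum gives \<open>N e = N (cnj e)\<close>,
  the real sum gives \<open>N e = m * N (- 1)\<close>, and the total \<open>2 * m + 1\<close> gives
  \<open>N (- 1) = 1\<close>.\<close>

lemma odd_equality:
  assumes w: "w = of_real r" and r0: "0 < r" and n: "n = 2 * m + 1" and m: "1 \<le> m"
    and d: "d = O_bound n r"
  obtains \<theta> where "cos \<theta> = odd_cos m r" "p = odd_extremal m \<theta>"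
proof -
  note D = odd_dichotomy[OF n m r0 eq_refl[OF d[symmetric]]]
  note u_eq = u_if_real[OF w r0] and z_eq' = z_eq_if_real[OF w r0]
  define e where "e = of_real r + 1 / Complex a s"
  have e': "cnj e = of_real r + 1 / Complex a (- s)" by (simp add: e_def complex_cnj)
  have nC: "Complex a s \<noteq> 0" "Complex a (- s) \<noteq> 0" using D(3) by (auto simp: complex_eq_iff)
  have a2s: "a\<^sup>2 + s\<^sup>2 \<noteq> 0" using D(4) d_pos by simp
  have ue: "u e = Complex a s" "u (cnj e) = Complex a (- s)"
    using nC unfolding e' by (simp_all add: u_eq e_def)
  have u1: "u (- 1) = of_real (- 1 / (1 + r))"
  proof -
    have "u (- 1) = 1 / of_real (- (1 + r))" unfolding u_eq by simp
    also have "\<dots> = of_real (1 / (- (1 + r)))" by (simp only: of_real_divide of_real_1)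
    also have "1 / (- (1 + r)) = - 1 / (1 + r)" by (simp only: divide_minus_right divide_minus_left)
    finally show ?thesis .
  qed
  have Im_e: "Im e \<noteq> 0" using D(3) a2s by (simp add: e_def Im_divide)
  have ne: "e \<noteq> cnj e" "e \<noteq> - 1" "cnj e \<noteq> - 1"
    using Im_e by (auto simp: complex_eq_iff)
  have ZS: "Z \<subseteq> {e, cnj e, - 1}"
  proof
    fix z assume z: "z \<in> Z"
    have "u z = u e \<or> u z = u (cnj e) \<or> u z = u (- 1)"
      using D(5)[OF z] unfolding ue u1 by (auto simp: complex_eq_iff abs_if split: if_splits)
    then show "z \<in> {e, cnj e, - 1}"
      using z_eq'[OF z] u_nonzero[OF z] by (auto simp: u_eq)
  qed
  note S = sum_N_superset[OF _ ZS]
  have "(\<Sum>z\<in>{e, cnj e, - 1}. real (N z) * Im (u z)) = 0"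
    using S sum_Im_u by simp
  then have NN: "N e = N (cnj e)" using ne D(3) by (simp add: ue u1)
  have "(\<Sum>z\<in>{e, cnj e, - 1}. real (N z) * Re (u z)) = 0"
    using S sum_Re_u by simp
  then have "2 * real (N e) * a = real (N (- 1)) / (1 + r)" using ne by (simp add: ue u1 NN mult_ac)
  then have "2 * real (N e) * a * (1 + r) = real (N (- 1))" using r0 by (simp add: field_simps)
  \<comment> \<open>Multiplying the real relation by \<open>m\<close> lets
    \<open>2 * m * (1 + r) * a = 1\<close> eliminate \<open>a\<close>.\<close>
  moreover have "real (N e) * (2 * real m * (1 + r) * a) = real m * (2 * real (N e) * a * (1 + r))"
    by (simp add: algebra_simps)
  ultimately have "real (N e) * (2 * real m * (1 + r) * a) = real m * real (N (- 1))" by simp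
  then have Ne: "N e = m * N (- 1)" unfolding D(2) by (metis mult.right_neutral of_nat_eq_iff of_nat_mult)
  have "(\<Sum>z\<in>{e, cnj e, - 1}. real (N z) * 1) = real n"
    using S[of "\<lambda>_. 1"] sum_N_real by simp
  then have "2 * N e + N (- 1) = n" using ne NN by simp
  then have "(2 * m + 1) * N (- 1) = (2 * m + 1) * 1" unfolding Ne n by (simp add: algebra_simps)
  then have N1: "N (- 1) = 1" by (simp only: mult_cancel1) simp
  have Nm: "N e = m" "N (cnj e) = m" using NN Ne N1 by simp_all
  \<comment> \<open>Since \<open>a^2 + s^2 = 1 / d^2\<close>, this is \<open>a * d^2\<close>, the
    real part of \<open>1 / Complex a s\<close>.\<close>
  have ad: "a / (a\<^sup>2 + s\<^sup>2) = ((1 - r\<^sup>2) - d\<^sup>2) / (2 * r)"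
    unfolding D(4) unfolding a_def using d_pos r0 by (simp add: field_simps)
  have Re_e: "Re e = r + a / (a\<^sup>2 + s\<^sup>2)" by (simp add: e_def Re_divide)
  have "2 * r * Re e = 1 + r\<^sup>2 - d\<^sup>2"
    unfolding Re_e ad using r0 by (simp add: field_simps power2_eq_square)
  also have "\<dots> = 2 * r * odd_cos m r"
    using odd_cos_O_bound[of r m] r_range m d n by simp
  finally have cos: "Re e = odd_cos m r" using r0 by simp
  \<comment> \<open>The distance \<open>d\<close> from \<open>r\<close> and the relation
    \<open>2 * r * Re e = 1 + r^2 - d^2\<close> together put \<open>e\<close> on the unit circle, so
    its argument serves as \<open>\<theta>\<close>.\<close>
  have "cmod e = 1"
  proof -
    have "(cmod (e - of_real r))\<^sup>2 = d\<^sup>2"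
      using D(4) by (simp add: e_def norm_divide power_divide cmod_power2)
    then have "(cmod e)\<^sup>2 = d\<^sup>2 + 2 * r * Re e - r\<^sup>2"
      unfolding cmod_power2 by (simp add: power2_eq_square algebra_simps)
    also have "\<dots> = 1" using \<open>2 * r * Re e = 1 + r\<^sup>2 - d\<^sup>2\<close> by simp
    finally show ?thesis using power2_eq_imp_eq[of "cmod e" 1] by simp
  qed
  moreover from this have "e \<noteq> 0" by auto
  ultimately have cis: "e = cis (Arg e)" using cis_Arg[of e] by (simp add: sgn_eq)
  have "p = [:- e, 1:] ^ N e * ([:- cnj e, 1:] ^ N (cnj e) * [:1, 1:] ^ N (- 1))"
    using poly_eq_prod[OF _ ZS] ne by simp
  then have "p = [:1, 1:] * [:- e, 1:] ^ m * [:- cnj e, 1:] ^ m"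
    unfolding Nm N1 power_one_right by (simp only: mult_ac)
  moreover have "cnj e = cis (- Arg e)" by (subst cis) (simp add: cis_cnj)
  ultimately have "p = odd_extremal m (Arg e)" unfolding odd_extremal_def using cis by metis
  moreover have "cos (Arg e) = odd_cos m r" using cos cis by (metis cis.simps(1))
  ultimately show ?thesis using that by blast
qed

end

section \<open>The sharp bound and its equality cases\<close>

lemma sharp_bound_nonneg: "0 \<le> r \<Longrightarrow> r \<le> 1 \<Longrightarrow> 0 \<le> sharp_bound n r"
  by (simp add: sharp_bound_def E_bound_def O_bound_nonneg power_le_one)

text \<open>Positivity ensures that equality rules out \<open>p w = 0\<close>, so the locale applies
  in the equality cases with \<open>0 < r < 1\<close>.\<close>

lemma sharp_bound_pos:
  assumes "0 < r" "r < 1" "2 \<le> n"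
  shows "0 < sharp_bound n r"
proof -
  have "r\<^sup>2 < 1" using assms by (simp add: power_less_one_iff)
  moreover have "0 < (real n - 1) + (real n + 1) * r" using assms by (simp add: add_pos_pos)
  ultimately show ?thesis using assms by (simp add: sharp_bound_def E_bound_def O_bound_def)
qed

lemma sharp_bound_at_0: "2 \<le> n \<Longrightarrow> sharp_bound n 0 = 1"
  by (simp add: sharp_bound_def E_bound_def O_bound_def)

lemma sharp_bound_at_1: "sharp_bound n 1 = 0"
  by (simp add: sharp_bound_def E_bound_def O_bound_def)

lemma dist_zeros_le_sharp_bound:
  assumes n: "2 \<le> n" and adm: "admissible n p" and crit: "critical_point p w"
  shows "dist_zeros w p \<le> sharp_bound n (cmod w)"
proof (cases "poly p w = 0")
  case True
  then have "dist_zeros w p = 0"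
    using dist_zeros_eq_0_iff[of p w] adm n by (simp add: admissible_def)
  \<comment> \<open>With distance 0 only nonnegativity of the bound is at issue, and this uses
    \<open>cmod w \<le> 1\<close>, here available because \<open>w\<close> is itself a zero.\<close>
  moreover have "cmod w \<le> 1" using True adm by (auto simp: admissible_def zeros_def)
  ultimately show ?thesis using sharp_bound_nonneg by simp
next
  case False
  interpret X: critical_non_zero n p w using n adm crit False by unfold_locales auto
  have "X.d \<le> sharp_bound n X.r"
  proof (cases "even n")
    case True
    then show ?thesis using X.d_le_E_bound by (simp add: sharp_bound_def)
  next
    case False
    then have "n = 2 * (n div 2) + 1" by simp
    then show ?thesis using X.d_le_O_bound[of "n div 2"] n False by (simp add: sharp_bound_def)
  qed
  then show ?thesis by (simp add: X.d_def X.r_def)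
qed

lemma even_equality_iff:
  assumes n: "2 \<le> n" "even n" and r: "0 < r" "r < 1"
  shows "admissible n p \<and> critical_point p (of_real r) \<and> dist_zeros (of_real r) p = E_bound r
    \<longleftrightarrow> p = even_extremal (n div 2) r"
proof
  assume L: "admissible n p \<and> critical_point p (of_real r) \<and> dist_zeros (of_real r) p = E_bound r"
  then have "dist_zeros (of_real r) p > 0" using sharp_bound_pos[OF r n(1)] n by (simp add: sharp_bound_def)
  then have "poly p (of_real r) \<noteq> 0"
    using dist_zeros_eq_0_iff[of p "of_real r"] L n(1) by (auto simp: admissible_def)
  with L n interpret X: critical_non_zero n p "of_real r" by unfold_locales auto
  have "X.r = r" using r by (simp add: X.r_def)
  then show "p = even_extremal (n div 2) r"
    using X.even_equality L r by (simp add: X.d_def)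
next
  assume "p = even_extremal (n div 2) r"
  then show "admissible n p \<and> critical_point p (of_real r) \<and> dist_zeros (of_real r) p = E_bound r"
    using even_extremal_attains[of r "n div 2"] n r by simp
qed

lemma odd_equality_iff:
  assumes n: "2 \<le> n" "odd n" and r: "0 < r" "r < 1"
  shows "admissible n p \<and> critical_point p (of_real r) \<and> dist_zeros (of_real r) p = O_bound n r
    \<longleftrightarrow> (\<exists>\<theta>. cos \<theta> = odd_cos (n div 2) r \<and> p = odd_extremal (n div 2) \<theta>)"
proof
  have n': "n = 2 * (n div 2) + 1" "1 \<le> n div 2" using n by auto
  {
    assume L: "admissible n p \<and> critical_point p (of_real r) \<and> dist_zeros (of_real r) p = O_bound n r"
    then have "dist_zeros (of_real r) p > 0" using sharp_bound_pos[OF r n(1)] n by (simp add: sharp_bound_def)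
    then have "poly p (of_real r) \<noteq> 0"
      using dist_zeros_eq_0_iff[of p "of_real r"] L n(1) by (auto simp: admissible_def)
    with L n interpret X: critical_non_zero n p "of_real r" by unfold_locales auto
    have Xr: "X.r = r" using r by (simp add: X.r_def)
    show "\<exists>\<theta>. cos \<theta> = odd_cos (n div 2) r \<and> p = odd_extremal (n div 2) \<theta>"
      by (rule X.odd_equality[OF _ _ n']) (use L r Xr in \<open>auto simp: X.d_def\<close>)
  next
    assume "\<exists>\<theta>. cos \<theta> = odd_cos (n div 2) r \<and> p = odd_extremal (n div 2) \<theta>"
    then obtain \<theta> where \<theta>: "cos \<theta> = odd_cos (n div 2) r" and p: "p = odd_extremal (n div 2) \<theta>" by blast
    show "admissible n p \<and> critical_point p (of_real r) \<and> dist_zeros (of_real r) p = O_bound n r"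
      unfolding p using odd_extremal_attains[OF _ _ n'(2) \<theta>] r n'(1) by simp
  }
qed

lemma sharp_bound_attained:
  assumes n: "2 \<le> n" and r: "0 \<le> r" "r \<le> 1"
  shows "\<exists>p. admissible n p \<and> critical_point p (of_real r) \<and> dist_zeros (of_real r) p = sharp_bound n r"
proof (cases "even n")
  case True
  then show ?thesis
    using even_extremal_attains[OF r, of "n div 2"] n by (intro exI[of _ "even_extremal (n div 2) r"]) (simp add: sharp_bound_def)
next
  case False
  then have n': "n = 2 * (n div 2) + 1" "1 \<le> n div 2" using n by auto
  \<comment> \<open>The witness angle exists because \<open>odd_cos\<close> takes values in
    \<open>[0, 1]\<close>.\<close>
  have "cos (arccos (odd_cos (n div 2) r)) = odd_cos (n div 2) r"
    using odd_cos_range[OF r n'(2)] by (intro cos_arccos) auto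
  from odd_extremal_attains[OF r n'(2) this] show ?thesis
    using False n'(1) by (intro exI[of _ "odd_extremal (n div 2) (arccos (odd_cos (n div 2) r))"]) (simp add: sharp_bound_def)
qed

text \<open>Distance 1 from the origin pushes all zeros onto the unit circle, where
  \<open>1 / z = cnj z\<close>; the critical point relation is then the conjugate of the vanishing
  sum of zeros.\<close>

lemma equality_at_0:
  assumes n: "2 \<le> n" and adm: "admissible n p" and crit: "critical_point p 0"
  shows "dist_zeros 0 p = 1 \<longleftrightarrow> zeros p \<subseteq> sphere 0 1 \<and> sum_mset (proots p) = 0"
proof
  assume L: "dist_zeros 0 p = 1"
  have deg: "degree p > 0" and p0: "p \<noteq> 0" using adm n by (auto simp: admissible_def)
  have nz: "poly p 0 \<noteq> 0" using dist_zeros_eq_0_iff[OF deg, of 0] L by auto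
  have norm: "cmod z = 1" if "z \<in> zeros p" for z
  proof -
    have "cmod z \<ge> 1" using dist_zeros_le[OF p0 that, of 0] L by simp
    moreover have "cmod z \<le> 1" using that adm by (auto simp: admissible_def)
    ultimately show ?thesis by simp
  qed
  have "cnj (sum_mset (proots p)) = (\<Sum>z\<in>zeros p. of_nat (order z p) * cnj z)"
    by (simp add: sum_mset_proots[OF p0])
  also have "\<dots> = (\<Sum>z\<in>zeros p. of_nat (order z p) / (z - 0))"
  proof (intro sum.cong refl)
    fix z assume "z \<in> zeros p"
    then have "cmod z = 1" by (rule norm)
    then have "cnj z = 1 / z" by (metis complex_div_cnj mult_1 complex_cnj_one norm_one one_power2
          div_by_1 of_real_1)
    then show "of_nat (order z p) * cnj z = of_nat (order z p) / (z - 0)" by simp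
  qed
  also have "\<dots> = 0" by (rule critical_point_order_sum[OF crit nz])
  finally show "zeros p \<subseteq> sphere 0 1 \<and> sum_mset (proots p) = 0" using norm by auto
next
  assume R: "zeros p \<subseteq> sphere 0 1 \<and> sum_mset (proots p) = 0"
  have "degree p > 0" using adm n by (simp add: admissible_def)
  then obtain z where "z \<in> zeros p" "dist_zeros 0 p = cmod (z - 0)" by (rule dist_zeros_attained)
  then show "dist_zeros 0 p = 1" using R by auto
qed

text \<open>Distance 0 means that \<open>w\<close> is a zero, and a zero that is also a critical
  point is multiple: its order exceeds its order in \<open>pderiv p\<close> by one.\<close>

lemma equality_at_1:
  assumes n: "2 \<le> n" and adm: "admissible n p" and crit: "critical_point p w"
  shows "dist_zeros w p = 0 \<longleftrightarrow> 2 \<le> order w p"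
proof -
  have deg: "degree p > 0" and p0: "p \<noteq> 0" using adm n by (auto simp: admissible_def)
  have dp: "pderiv p \<noteq> 0" using deg by (simp add: pderiv_eq_0_iff)
  have "poly p w = 0 \<longleftrightarrow> 2 \<le> order w p"
  proof
    assume "poly p w = 0"
    then have "order w p = Suc (order w (pderiv p))" using order_pderiv[OF p0] by simp
    moreover have "order w (pderiv p) \<noteq> 0"
      using crit dp by (simp add: critical_point_def order_root)
    ultimately show "2 \<le> order w p" by simp
  qed (use p0 in \<open>auto simp: order_root\<close>)
  then show ?thesis using dist_zeros_eq_0_iff[OF deg] by simp
qed

theorem theorem1:
  fixes n :: nat
  assumes "n \<ge> 2"
  shows
    "(\<forall>p w. admissible n p \<and> critical_point p w \<longrightarrow>
        (even n \<longrightarrow> dist_zeros w p \<le> E_bound (cmod w)) \<and>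
        (odd n \<longrightarrow> dist_zeros w p \<le> O_bound n (cmod w)))
   \<and> (\<forall>r::real. 0 \<le> r \<and> r \<le> 1 \<longrightarrow>
        (\<exists>p w. admissible n p \<and> critical_point p w \<and> cmod w = r \<and>
               dist_zeros w p = sharp_bound n r))
   \<and> (\<forall>r::real. 0 < r \<and> r < 1 \<longrightarrow>
        (even n \<longrightarrow>
          (\<forall>p. admissible n p \<and> critical_point p (complex_of_real r) \<and>
               dist_zeros (complex_of_real r) p = E_bound r \<longleftrightarrow>
               p = even_extremal (n div 2) r)) \<and>
        (odd n \<longrightarrow>
          (\<forall>p. admissible n p \<and> critical_point p (complex_of_real r) \<and>
               dist_zeros (complex_of_real r) p = O_bound n r \<longleftrightarrow>
               (\<exists>\<theta>::real.
                  cos \<theta> = ((2 * real (n div 2) + 1) * r\<^sup>2 + 2 * real (n div 2) * r + 1) /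
                          (2 * (real (n div 2) + (real (n div 2) + 1) * r)) \<and>
                  p = odd_extremal (n div 2) \<theta>))))
   \<and> (\<forall>p w. admissible n p \<and> critical_point p w \<and> cmod w = 0 \<longrightarrow>
        (dist_zeros w p = sharp_bound n 0 \<longleftrightarrow>
           zeros p \<subseteq> sphere 0 1 \<and> sum_mset (proots p) = w \<and> w = 0))
   \<and> (\<forall>p w. admissible n p \<and> critical_point p w \<and> cmod w = 1 \<longrightarrow>
        (dist_zeros w p = sharp_bound n 1 \<longleftrightarrow> order w p \<ge> 2))"
proof (intro conjI allI impI)
  fix p w assume "admissible n p \<and> critical_point p w"
  then have le: "dist_zeros w p \<le> sharp_bound n (cmod w)"
    using dist_zeros_le_sharp_bound[OF assms] by blast
  show "dist_zeros w p \<le> E_bound (cmod w)" if "even n" using le that by (simp add: sharp_bound_def)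
  show "dist_zeros w p \<le> O_bound n (cmod w)" if "odd n" using le that by (simp add: sharp_bound_def)
next
  fix r :: real assume r: "0 \<le> r \<and> r \<le> 1"
  then obtain p where "admissible n p" "critical_point p (of_real r)"
      "dist_zeros (of_real r) p = sharp_bound n r"
    using sharp_bound_attained[OF assms] by blast
  moreover have "cmod (of_real r) = r" using r by simp
  ultimately show "\<exists>p w. admissible n p \<and> critical_point p w \<and> cmod w = r \<and>
      dist_zeros w p = sharp_bound n r" by blast
next
  fix r :: real and p assume "0 < r \<and> r < 1" "even n"
  then show "admissible n p \<and> critical_point p (complex_of_real r) \<and>
      dist_zeros (complex_of_real r) p = E_bound r \<longleftrightarrow> p = even_extremal (n div 2) r"
    using even_equality_iff[OF assms] by blast
next
  fix r :: real and p assume "0 < r \<and> r < 1" "odd n"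
  then show "admissible n p \<and> critical_point p (complex_of_real r) \<and>
      dist_zeros (complex_of_real r) p = O_bound n r \<longleftrightarrow>
      (\<exists>\<theta>::real.
        cos \<theta> = ((2 * real (n div 2) + 1) * r\<^sup>2 + 2 * real (n div 2) * r + 1) /
                (2 * (real (n div 2) + (real (n div 2) + 1) * r)) \<and>
        p = odd_extremal (n div 2) \<theta>)"
    using odd_equality_iff[OF assms] unfolding odd_cos_def by blast
next
  fix p w assume "admissible n p \<and> critical_point p w \<and> cmod w = 0"
  then show "dist_zeros w p = sharp_bound n 0 \<longleftrightarrow>
      zeros p \<subseteq> sphere 0 1 \<and> sum_mset (proots p) = w \<and> w = 0"
    using equality_at_0[OF assms] sharp_bound_at_0[OF assms] by auto
next
  fix p w assume "admissible n p \<and> critical_point p w \<and> cmod w = 1"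
  then show "dist_zeros w p = sharp_bound n 1 \<longleftrightarrow> order w p \<ge> 2"
    using equality_at_1[OF assms] sharp_bound_at_1 by simp
qed

end
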